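(* Suppose the Coffman–Sethi conjecture is false. Then every minimal counterexample of Type IR and every minimal counterexample of Type I, having $k$ ranks, satisfies $\frac{t_{LD}}{t^*}<\frac{k}{k-1}$.
   Context: Problem FM: there are $m\ge 1$ identical parallel machines and $n=mk$ jobs ($k\ge 1$ is the number of ranks; an instance with fewer jobs is padded with jobs of processing time $0$), with nonnegative real processing times indexed so that $p_1\ge p_2\ge\cdots\ge p_n$. For $r\in\{1,\dots,k\}$, rank $r$ is the set of jobs $(r-1)m+1,\dots,rm$. A flowtime-optimal schedule assigns to every machine exactly one job from each rank and processes the jobs on each machine consecutively from time $0$ without idle time, in the order rank $k$, rank $k-1$, \dots, rank $1$; its makespan is the largest machine completion time. $t^*$ denotes the minimum makespan over all flowtime-optimal schedules; flowtime-optimal schedules attaining it are optimal, and a schedule is rectangular if all machines have the same completion time. LD algorithm: ranks are handled in the order $1,2,\dots,k$; when handling a rank, the largest job of that rank is assigned to a machine of smallest current load (sum of processing times of jobs already assigned), the second largest to a machine of second smallest load, \dots, the smallest to a machine of largest load (ties broken arbitrarily); at the end the order of jobs on each machine is reversed, yielding a flowtime-optimal schedule. Any schedule obtainable this way is an LD schedule. The Coffman–Sethi conjecture asserts that for every $m$, every instance on $m$ machines and every LD schedule, the makespan of the LD schedule is at most $\frac{5m-2}{4m-1}t^*$; a counterexample is an instance having an LD schedule violating this. Here $t_{LD}$ denotes the largest makespan over the LD schedules of the instance, and $t_{LD}/t^*$ is its approximation ratio. Types: any instance is of Type A; Type I if all processing times are integers; Type R if it has a rectangular optimal schedule; Type IR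 if it is of Types I and R. A counterexample of a given type is a counterexample which is an instance of that type. A counterexample $P_2$ is smaller than a counterexample $P_1$ with $k$ ranks and $m$ machines if (i) $P_2$ has fewer than $k$ ranks, or (ii) $P_2$ has $k$ ranks and fewer than $m$ machines, or (iii) $P_2$ has $k$ ranks, $m$ machines and fewer jobs with nonzero processing time, or (iv) $P_2$ has $k$ ranks, $m$ machines, the same number of jobs with nonzero processing time and a strictly larger approximation ratio, or (v) (for types requiring integer data) $P_2$ has $k$ ranks, $m$ machines, the same number of nonzero jobs, the same approximation ratio and a strictly smaller sum of processing times. A minimal counterexample of a given type is a counterexample of that type such that no counterexample of the same type is smaller than it. *)

theory Defs
  imports Complex_Main
begin

text \<open>
  Jobs are numbered \<open>1..m * k\<close> and machines \<open>1..m\<close>; values of \<open>ptime\<close> at other indices are irrelevant.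
\<close>

record fm_instance =
  machines :: nat
  ranks :: nat
  ptime :: "nat \<Rightarrow> real"

definition jobs :: "fm_instance \<Rightarrow> nat set" where
  "jobs P = {1..machines P * ranks P}"

definition is_instance :: "fm_instance \<Rightarrow> bool" where
  "is_instance P \<longleftrightarrow>
     machines P \<ge> 1 \<and> ranks P \<ge> 1 \<and>
     (\<forall>j\<in>jobs P. 0 \<le> ptime P j) \<and>
     (\<forall>i\<in>jobs P. \<forall>j\<in>jobs P. i \<le> j \<longrightarrow> ptime P j \<le> ptime P i)"

definition rank_jobs :: "fm_instance \<Rightarrow> nat \<Rightarrow> nat set" where
  "rank_jobs P r = {(r - 1) * machines P + 1..r * machines P}"

text \<open>
  A flowtime-optimal schedule is represented by the map \<open>\<sigma>\<close> sending each job to its machine: the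
  order of the jobs on a machine (rank \<open>k\<close> first, rank \<open>1\<close> last) and their starting times (no idle
  time, start at \<open>0\<close>) are determined by the assignment.  For the same reason the final reversal in
  the LD algorithm does not appear in \<open>ld_schedule\<close> below.
\<close>

definition flowtime_optimal :: "fm_instance \<Rightarrow> (nat \<Rightarrow> nat) \<Rightarrow> bool" where
  "flowtime_optimal P \<sigma> \<longleftrightarrow>
     (\<forall>r\<in>{1..ranks P}. bij_betw \<sigma> (rank_jobs P r) {1..machines P})"

text \<open>The load of machine \<open>i\<close> when exactly the jobs of ranks \<open>1..r\<close> have been assigned.\<close>

definition load :: "fm_instance \<Rightarrow> (nat \<Rightarrow> nat) \<Rightarrow> nat \<Rightarrow> nat \<Rightarrow> real" where
  "load P \<sigma> r i = (\<Sum>j | j \<in> {1..r * machines P} \<and> \<sigma> j = i. ptime P j)"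

definition completion_time :: "fm_instance \<Rightarrow> (nat \<Rightarrow> nat) \<Rightarrow> nat \<Rightarrow> real" where
  "completion_time P \<sigma> i = (\<Sum>j | j \<in> jobs P \<and> \<sigma> j = i. ptime P j)"

definition makespan :: "fm_instance \<Rightarrow> (nat \<Rightarrow> nat) \<Rightarrow> real" where
  "makespan P \<sigma> = Max (completion_time P \<sigma> ` {1..machines P})"

definition t_star :: "fm_instance \<Rightarrow> real" where
  "t_star P = Min {makespan P \<sigma> | \<sigma>. flowtime_optimal P \<sigma>}"

definition optimal :: "fm_instance \<Rightarrow> (nat \<Rightarrow> nat) \<Rightarrow> bool" where
  "optimal P \<sigma> \<longleftrightarrow> flowtime_optimal P \<sigma> \<and> makespan P \<sigma> = t_star P"

definition rectangular :: "fm_instance \<Rightarrow> (nat \<Rightarrow> nat) \<Rightarrow> bool" where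
  "rectangular P \<sigma> \<longleftrightarrow>
     (\<forall>i\<in>{1..machines P}. \<forall>i'\<in>{1..machines P}. completion_time P \<sigma> i = completion_time P \<sigma> i')"

text \<open>
  Handling rank \<open>r\<close>: \<open>job\<close> lists the jobs of the rank from largest to smallest and \<open>mach\<close> lists the
  machines from smallest to largest current load, ties being broken arbitrarily in both lists; the
  \<open>i\<close>-th job goes to the \<open>i\<close>-th machine.
\<close>

definition ld_step :: "fm_instance \<Rightarrow> (nat \<Rightarrow> nat) \<Rightarrow> nat \<Rightarrow> bool" where
  "ld_step P \<sigma> r \<longleftrightarrow>
     (\<exists>job mach.
        bij_betw job {1..machines P} (rank_jobs P r) \<and>
        bij_betw mach {1..machines P} {1..machines P} \<and>
        (\<forall>i\<in>{1..machines P}. \<forall>i'\<in>{1..machines P}. i \<le> i' \<longrightarrow>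
           ptime P (job i') \<le> ptime P (job i) \<and>
           load P \<sigma> (r - 1) (mach i) \<le> load P \<sigma> (r - 1) (mach i')) \<and>
        (\<forall>i\<in>{1..machines P}. \<sigma> (job i) = mach i))"

definition ld_schedule :: "fm_instance \<Rightarrow> (nat \<Rightarrow> nat) \<Rightarrow> bool" where
  "ld_schedule P \<sigma> \<longleftrightarrow> (\<forall>r\<in>{1..ranks P}. ld_step P \<sigma> r)"

definition t_LD :: "fm_instance \<Rightarrow> real" where
  "t_LD P = Max {makespan P \<sigma> | \<sigma>. ld_schedule P \<sigma>}"

definition approx_ratio :: "fm_instance \<Rightarrow> real" where
  "approx_ratio P = t_LD P / t_star P"

definition cs_bound :: "nat \<Rightarrow> real" where
  "cs_bound m = (5 * real m - 2) / (4 * real m - 1)"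

definition coffman_sethi_conjecture :: bool where
  "coffman_sethi_conjecture \<longleftrightarrow>
     (\<forall>P \<sigma>. is_instance P \<longrightarrow> ld_schedule P \<sigma> \<longrightarrow>
        makespan P \<sigma> \<le> cs_bound (machines P) * t_star P)"

definition counterexample :: "fm_instance \<Rightarrow> bool" where
  "counterexample P \<longleftrightarrow>
     is_instance P \<and>
     (\<exists>\<sigma>. ld_schedule P \<sigma> \<and> \<not> makespan P \<sigma> \<le> cs_bound (machines P) * t_star P)"

datatype instance_type = Type_A | Type_I | Type_R | Type_IR

definition integral_instance :: "fm_instance \<Rightarrow> bool" where
  "integral_instance P \<longleftrightarrow> (\<forall>j\<in>jobs P. ptime P j \<in> \<int>)"

definition rectangular_instance :: "fm_instance \<Rightarrow> bool" where
  "rectangular_instance P \<longleftrightarrow> (\<exists>\<sigma>. optimal P \<sigma> \<and> rectangular P \<sigma>)"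

fun has_type :: "instance_type \<Rightarrow> fm_instance \<Rightarrow> bool" where
  "has_type Type_A P \<longleftrightarrow> True"
| "has_type Type_I P \<longleftrightarrow> integral_instance P"
| "has_type Type_R P \<longleftrightarrow> rectangular_instance P"
| "has_type Type_IR P \<longleftrightarrow> integral_instance P \<and> rectangular_instance P"

definition nonzero_jobs :: "fm_instance \<Rightarrow> nat" where
  "nonzero_jobs P = card {j \<in> jobs P. ptime P j \<noteq> 0}"

definition total_time :: "fm_instance \<Rightarrow> real" where
  "total_time P = (\<Sum>j\<in>jobs P. ptime P j)"

text \<open>
  \<open>smaller T Q P\<close>: among counterexamples of type \<open>T\<close>, \<open>Q\<close> is smaller than \<open>P\<close>.  The sum of
  processing times is only compared for the types with integer data.
\<close>

definition smaller :: "instance_type \<Rightarrow> fm_instance \<Rightarrow> fm_instance \<Rightarrow> bool" where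
  "smaller T Q P \<longleftrightarrow>
     ranks Q < ranks P \<or>
     (ranks Q = ranks P \<and> machines Q < machines P) \<or>
     (ranks Q = ranks P \<and> machines Q = machines P \<and> nonzero_jobs Q < nonzero_jobs P) \<or>
     (ranks Q = ranks P \<and> machines Q = machines P \<and> nonzero_jobs Q = nonzero_jobs P \<and>
        approx_ratio Q > approx_ratio P) \<or>
     (T \<in> {Type_I, Type_IR} \<and>
        ranks Q = ranks P \<and> machines Q = machines P \<and> nonzero_jobs Q = nonzero_jobs P \<and>
        approx_ratio Q = approx_ratio P \<and> total_time Q < total_time P)"

definition minimal_counterexample :: "instance_type \<Rightarrow> fm_instance \<Rightarrow> bool" where
  "minimal_counterexample T P \<longleftrightarrow>
     counterexample P \<and> has_type T P \<and>
     \<not> (\<exists>Q. counterexample Q \<and> has_type T Q \<and> smaller T Q P)"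

end

theory Submission
  imports Defs
begin

text \<open>
  A minimal counterexample has at least two ranks, and rank \<open>k\<close> contains a positive job, since
  otherwise that rank could be dropped; hence all jobs of ranks \<open>1..k - 1\<close> are positive.  Suppose
  \<open>t_LD / t* \<ge> k / (k - 1)\<close>.  Fix an optimal schedule and lower some processing times by one such
  that every machine loses exactly \<open>k - 1\<close>; this keeps rectangularity and lowers \<open>t*\<close> by at least
  \<open>k - 1\<close>.  Each job loses at most one and the sorted LD load vector is monotone in
  the processing times, so \<open>t_LD\<close> drops by at most \<open>k\<close>.  As \<open>(t_LD - k) / (t* - (k - 1)) \<ge> t_LD / t*\<close>,
  the new instance is a smaller counterexample of the same type.
\<close>

section \<open>Sorted enumerations and comparison of sorted vectors\<close>

text \<open>Negating \<open>f\<close> gives decreasing enumerations, so this serves both lists of an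
  LD step as well as the later reordering of rank 1.\<close>

lemma ex_sorting_bij:
  fixes f :: "nat \<Rightarrow> real"
  assumes "finite A" "card A = m"
  shows "\<exists>s. bij_betw s {1..m} A \<and> (\<forall>i\<in>{1..m}. \<forall>j\<in>{1..m}. i \<le> j \<longrightarrow> f (s i) \<le> f (s j))"
proof -
  define xs where "xs = sort_key f (sorted_list_of_set A)"
  have xs: "set xs = A" "length xs = m" "distinct xs" "sorted (map f xs)"
    using assms by (auto simp: xs_def)
  have "bij_betw (\<lambda>i. i - 1) {1..m} {..<m}"
    by (rule bij_betw_byWitness[where f' = Suc]) auto
  moreover have "bij_betw ((!) xs) {..<m} A"
    using xs by (intro bij_betw_nth) auto
  ultimately have "bij_betw ((!) xs \<circ> (\<lambda>i. i - 1)) {1..m} A"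
    by (rule bij_betw_trans)
  moreover have "f (xs ! (i - 1)) \<le> f (xs ! (j - 1))"
    if "i \<in> {1..m}" "j \<in> {1..m}" "i \<le> j" for i j
    using sorted_nth_mono[OF xs(4), of "i - 1" "j - 1"] that xs(2) by auto
  ultimately show ?thesis
    by (intro exI[of _ "(!) xs \<circ> (\<lambda>i. i - 1)"]) auto
qed

text \<open>Pigeonhole: the indices from \<open>i\<close> to \<open>m\<close> are too many to be
  mapped injectively above \<open>i\<close>, so some \<open>x\<close> at or after \<open>i\<close>
  has \<open>b x\<close> at most \<open>i\<close>. Then \<open>f i\<close>, \<open>f x\<close>,
  \<open>g (b x)\<close>, \<open>g i\<close> is a nondecreasing chain.\<close>

lemma sorted_le_of_bij_le:
  fixes f g :: "nat \<Rightarrow> real"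
  assumes f: "\<forall>i\<in>{1..m}. \<forall>j\<in>{1..m}. i \<le> j \<longrightarrow> f i \<le> f j"
    and g: "\<forall>i\<in>{1..m}. \<forall>j\<in>{1..m}. i \<le> j \<longrightarrow> g i \<le> g j"
    and b: "bij_betw b {1..m} {1..m}"
    and le: "\<forall>i\<in>{1..m}. f i \<le> g (b i)"
    and i: "i \<in> {1..m}"
  shows "f i \<le> g i"
proof -
  have inj: "inj_on b {i..m}"
    using b i by (auto simp: bij_betw_def intro: inj_on_subset)
  have "\<exists>x\<in>{i..m}. b x \<le> i"
  proof (rule ccontr)
    assume "\<not> ?thesis"
    moreover have "b ` {i..m} \<subseteq> {1..m}"
      using bij_betwE[OF b] i by auto
    ultimately have "b ` {i..m} \<subseteq> {Suc i..m}"
      by (auto simp: not_le Suc_le_eq)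
    then have "card {i..m} \<le> card {Suc i..m}"
      using card_image[OF inj] card_mono[of "{Suc i..m}" "b ` {i..m}"] by simp
    then show False
      using i by auto
  qed
  then obtain x where x: "x \<in> {i..m}" "b x \<le> i"
    by blast
  then have x1: "x \<in> {1..m}" "b x \<in> {1..m}"
    using i bij_betwE[OF b] by auto
  have "f i \<le> f x"
    using f i x x1 by auto
  also have "\<dots> \<le> g (b x)"
    using le x1 by blast
  also have "\<dots> \<le> g i"
    using g i x x1 by blast
  finally show ?thesis .
qed

text \<open>Negation reverses the order and swaps the roles of \<open>f\<close> and
  \<open>g\<close>, which is why \<open>b\<close> acts on the side of \<open>f\<close> here.\<close>

lemma antisorted_le_of_bij_le:
  fixes f g :: "nat \<Rightarrow> real"
  assumes f: "\<forall>i\<in>{1..m}. \<forall>j\<in>{1..m}. i \<le> j \<longrightarrow> f j \<le> f i"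
    and g: "\<forall>i\<in>{1..m}. \<forall>j\<in>{1..m}. i \<le> j \<longrightarrow> g j \<le> g i"
    and b: "bij_betw b {1..m} {1..m}"
    and le: "\<forall>i\<in>{1..m}. f (b i) \<le> g i"
    and i: "i \<in> {1..m}"
  shows "f i \<le> g i"
  using sorted_le_of_bij_le[of m "\<lambda>i. - g i" "\<lambda>i. - f i" b i] assms by simp

section \<open>Ranks and machine loads\<close>

lemma finite_rank_jobs [simp]: "finite (rank_jobs P r)"
  by (simp add: rank_jobs_def)

lemma card_rank_jobs: "r \<ge> 1 \<Longrightarrow> card (rank_jobs P r) = machines P"
  by (cases r) (auto simp: rank_jobs_def)

lemma rank_jobs_subset_jobs:
  assumes "r \<in> {1..ranks P}"
  shows "rank_jobs P r \<subseteq> jobs P"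
proof -
  have "r * machines P \<le> machines P * ranks P"
    using assms by (simp add: mult.commute)
  then show ?thesis
    unfolding rank_jobs_def jobs_def by (auto intro: order_trans)
qed

lemma rank_jobs_gt:
  assumes "r \<ge> 2" "j \<in> rank_jobs P r"
  shows "machines P < j"
proof -
  have "1 * machines P \<le> (r - 1) * machines P"
    using assms by (intro mult_right_mono) auto
  also have "\<dots> < j"
    using assms by (simp add: rank_jobs_def)
  finally show ?thesis
    by simp
qed

lemma completion_time_eq_load: "completion_time P \<sigma> i = load P \<sigma> (ranks P) i"
  by (simp add: completion_time_def load_def jobs_def mult.commute)

lemma load_Suc:
  assumes "inj_on \<sigma> (rank_jobs P (Suc r))" "j \<in> rank_jobs P (Suc r)" "\<sigma> j = i"
  shows "load P \<sigma> (Suc r) i = load P \<sigma> r i + ptime P j"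
proof -
  let ?A = "{j. j \<in> {1..r * machines P} \<and> \<sigma> j = i}"
  have "{1..Suc r * machines P} = {1..r * machines P} \<union> rank_jobs P (Suc r)"
    by (auto simp: rank_jobs_def)
  then have "{j. j \<in> {1..Suc r * machines P} \<and> \<sigma> j = i} = insert j ?A"
    using assms by (auto dest: inj_onD)
  moreover have "j \<notin> ?A"
    using assms by (auto simp: rank_jobs_def)
  ultimately show ?thesis
    by (simp add: load_def)
qed

lemma load_0 [simp]: "load P \<sigma> 0 i = 0"
  by (simp add: load_def)

lemma load_cong:
  assumes "\<And>j. j \<in> {1..r * machines P} \<Longrightarrow> \<sigma> j = \<tau> j"
  shows "load P \<sigma> r i = load P \<tau> r i"
  unfolding load_def using assms by (intro sum.cong) auto

section \<open>Existence of LD schedules\<close>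

lemma ld_step_bij:
  assumes "ld_step P \<sigma> r"
  shows "bij_betw \<sigma> (rank_jobs P r) {1..machines P}"
proof -
  obtain job mach where job: "bij_betw job {1..machines P} (rank_jobs P r)"
    and mach: "bij_betw mach {1..machines P} {1..machines P}"
    and eq: "\<forall>i\<in>{1..machines P}. \<sigma> (job i) = mach i"
    using assms unfolding ld_step_def by blast
  have "bij_betw (\<sigma> \<circ> job) {1..machines P} {1..machines P}"
    using mach eq bij_betw_cong[of "{1..machines P}" "\<sigma> \<circ> job" mach] by simp
  then show ?thesis
    using bij_betw_comp_iff[OF job] by blast
qed

lemma ld_schedule_flowtime_optimal: "ld_schedule P \<sigma> \<Longrightarrow> flowtime_optimal P \<sigma>"
  unfolding ld_schedule_def flowtime_optimal_def using ld_step_bij by blast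

text \<open>A step at rank \<open>r\<close> looks only at the assignment of ranks up to
  \<open>r\<close>, so a partial LD schedule can be extended without spoiling its earlier
  steps.\<close>

lemma ld_step_cong:
  assumes eq: "\<And>j. j \<in> {1..r * machines P} \<Longrightarrow> \<sigma> j = \<tau> j"
    and "ld_step P \<sigma> r"
  shows "ld_step P \<tau> r"
proof -
  have le: "(r - 1) * machines P \<le> r * machines P"
    by simp
  have l: "load P \<sigma> (r - 1) i = load P \<tau> (r - 1) i" for i
    by (intro load_cong eq) (use le in \<open>meson atLeastAtMost_iff order_trans\<close>)
  have s: "\<sigma> j = \<tau> j" if "j \<in> rank_jobs P r" for j
    using that by (intro eq) (auto simp: rank_jobs_def)
  obtain job mach where *: "bij_betw job {1..machines P} (rank_jobs P r)"
    "bij_betw mach {1..machines P} {1..machines P}"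
    "\<forall>i\<in>{1..machines P}. \<forall>i'\<in>{1..machines P}. i \<le> i' \<longrightarrow>
       ptime P (job i') \<le> ptime P (job i) \<and>
       load P \<tau> (r - 1) (mach i) \<le> load P \<tau> (r - 1) (mach i')"
    "\<forall>i\<in>{1..machines P}. \<sigma> (job i) = mach i"
    using assms(2) unfolding ld_step_def l by blast
  moreover have "\<forall>i\<in>{1..machines P}. \<tau> (job i) = mach i"
    using * s bij_betwE[OF *(1)] by simp
  ultimately show ?thesis
    unfolding ld_step_def by blast
qed

lemma ex_ld_steps: "\<exists>\<sigma>. \<forall>r\<in>{1..n}. ld_step P \<sigma> r"
proof (induction n)
  case 0
  show ?case by simp
next
  case (Suc n)
  let ?m = "machines P"
  obtain \<sigma> where \<sigma>: "\<forall>r\<in>{1..n}. ld_step P \<sigma> r"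
    using Suc by blast
  obtain job where job: "bij_betw job {1..?m} (rank_jobs P (Suc n))"
    "\<forall>i\<in>{1..?m}. \<forall>j\<in>{1..?m}. i \<le> j \<longrightarrow> - ptime P (job i) \<le> - ptime P (job j)"
    using ex_sorting_bij[OF finite_rank_jobs card_rank_jobs[of "Suc n" P], of "\<lambda>j. - ptime P j"]
    by auto
  obtain mach where mach: "bij_betw mach {1..?m} {1..?m}"
    "\<forall>i\<in>{1..?m}. \<forall>j\<in>{1..?m}. i \<le> j \<longrightarrow> load P \<sigma> n (mach i) \<le> load P \<sigma> n (mach j)"
    using ex_sorting_bij[of "{1..?m}" ?m "load P \<sigma> n"] by auto
  \<comment> \<open>On the new rank, \<open>inv_into\<close> recovers the position of a job in the
    decreasing list and \<open>mach\<close> turns it into a machine.\<close>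
  define \<tau> where
    "\<tau> j = (if j \<in> rank_jobs P (Suc n) then mach (inv_into {1..?m} job j) else \<sigma> j)" for j
  have eq: "\<sigma> j = \<tau> j" if "j \<in> {1..n * ?m}" for j
    using that by (auto simp: \<tau>_def rank_jobs_def)
  have "ld_step P \<tau> r" if "r \<in> {1..n}" for r
  proof (rule ld_step_cong[of _ _ \<sigma>])
    have "r * ?m \<le> n * ?m"
      using that by simp
    then show "\<sigma> j = \<tau> j" if "j \<in> {1..r * ?m}" for j
      using that by (intro eq) (meson atLeastAtMost_iff order_trans)
  qed (use \<sigma> that in auto)
  moreover have "ld_step P \<tau> (Suc n)"
    unfolding ld_step_def
  proof (rule exI[of _ job], rule exI[of _ mach], intro conjI ballI impI)
    fix i assume "i \<in> {1..?m}"
    then show "\<tau> (job i) = mach i"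
      using bij_betwE[OF job(1)] bij_betw_inv_into_left[OF job(1)] by (simp add: \<tau>_def)
  next
    fix i j assume "i \<in> {1..?m}" "j \<in> {1..?m}" "i \<le> j"
    then show "load P \<tau> (Suc n - 1) (mach i) \<le> load P \<tau> (Suc n - 1) (mach j)"
      using mach(2) load_cong[of n P \<sigma> \<tau>, OF eq] by simp
  qed (use job mach in auto)
  ultimately have "\<forall>r\<in>{1..Suc n}. ld_step P \<tau> r"
    using le_Suc_eq by auto
  then show ?case by blast
qed

lemma ex_ld_schedule: "\<exists>\<sigma>. ld_schedule P \<sigma>"
  using ex_ld_steps by (auto simp: ld_schedule_def)

section \<open>Makespans and the optimum\<close>

lemma completion_time_le_makespan:
  "i \<in> {1..machines P} \<Longrightarrow> completion_time P \<sigma> i \<le> makespan P \<sigma>"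
  by (auto simp: makespan_def)

lemma makespan_attained:
  assumes "machines P \<ge> 1"
  obtains i where "i \<in> {1..machines P}" "makespan P \<sigma> = completion_time P \<sigma> i"
proof -
  have "makespan P \<sigma> \<in> completion_time P \<sigma> ` {1..machines P}"
    unfolding makespan_def using assms by (intro Max_in) auto
  then show thesis
    using that by blast
qed

text \<open>There are infinitely many maps \<sigma>, as their values off the jobs are free, but each
  makespan is the sum of the times over some set of jobs. This makes the \<open>Min\<close> in
  \<open>t_star\<close> meaningful.\<close>

lemma finite_makespans:
  assumes "machines P \<ge> 1"
  shows "finite {makespan P \<sigma> | \<sigma>. flowtime_optimal P \<sigma>}"
proof (rule finite_subset)
  show "{makespan P \<sigma> | \<sigma>. flowtime_optimal P \<sigma>} \<subseteq> sum (ptime P) ` Pow (jobs P)"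
  proof safe
    fix \<sigma>
    obtain i where "makespan P \<sigma> = completion_time P \<sigma> i"
      using makespan_attained[OF assms] by blast
    then show "makespan P \<sigma> \<in> sum (ptime P) ` Pow (jobs P)"
      unfolding completion_time_def by auto
  qed
qed (simp add: jobs_def)

lemma t_star_le:
  assumes "machines P \<ge> 1" "flowtime_optimal P \<sigma>"
  shows "t_star P \<le> makespan P \<sigma>"
  unfolding t_star_def using assms finite_makespans by (intro Min_le) auto

lemma ex_optimal:
  assumes "machines P \<ge> 1"
  shows "\<exists>\<sigma>. optimal P \<sigma>"
proof -
  have "t_star P \<in> {makespan P \<sigma> | \<sigma>. flowtime_optimal P \<sigma>}"
    unfolding t_star_def using finite_makespans[OF assms] ex_ld_schedule[of P]
    by (intro Min_in) (auto dest: ld_schedule_flowtime_optimal)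
  then show ?thesis
    by (auto simp: optimal_def)
qed

lemma flowtime_optimal_range:
  assumes "flowtime_optimal P \<sigma>" "j \<in> jobs P"
  shows "\<sigma> j \<in> {1..machines P}"
proof -
  let ?m = "machines P"
  have j: "1 \<le> j" "j \<le> ?m * ranks P"
    using assms by (auto simp: jobs_def)
  then have m: "?m > 0"
    by (cases "?m = 0") auto
  \<comment> \<open>The rank of \<open>j\<close> counted from 0; jobs are numbered from 1, hence
    \<open>j - 1\<close>.\<close>
  define q where "q = (j - 1) div ?m"
  have "q < ranks P"
    using j m by (simp add: q_def div_less_iff_less_mult mult.commute)
  moreover have "j \<in> rank_jobs P (Suc q)"
  proof -
    have "q * ?m \<le> j - 1" "j - 1 < ?m + q * ?m"
      unfolding q_def using div_times_less_eq_dividend dividend_less_div_times[OF m] by auto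
    then show ?thesis
      using j unfolding rank_jobs_def by auto
  qed
  ultimately show ?thesis
    using assms(1) bij_betwE[of \<sigma> "rank_jobs P (Suc q)" "{1..?m}"]
    by (simp add: flowtime_optimal_def)
qed

lemma sum_completion_time:
  assumes "flowtime_optimal P \<sigma>"
  shows "(\<Sum>i\<in>{1..machines P}. completion_time P \<sigma> i) = total_time P"
  unfolding completion_time_def total_time_def
  using sum.group[of "jobs P" "{1..machines P}" \<sigma> "ptime P"] flowtime_optimal_range[OF assms]
  by (simp add: jobs_def image_subset_iff)

lemma total_time_le:
  assumes "flowtime_optimal P \<sigma>"
  shows "total_time P \<le> real (machines P) * makespan P \<sigma>"
  unfolding sum_completion_time[OF assms, symmetric]
  using sum_bounded_above[of "{1..machines P}" "completion_time P \<sigma>" "makespan P \<sigma>"]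
    completion_time_le_makespan by simp

lemma makespan_le_total_time:
  assumes "is_instance P"
  shows "makespan P \<sigma> \<le> total_time P"
proof -
  have "machines P \<ge> 1"
    using assms by (simp add: is_instance_def)
  then obtain i where "makespan P \<sigma> = completion_time P \<sigma> i"
    by (rule makespan_attained)
  also have "\<dots> \<le> total_time P"
    unfolding completion_time_def total_time_def using assms
    by (intro sum_mono2) (auto simp: is_instance_def jobs_def)
  finally show ?thesis .
qed

text \<open>The total time lies between the two sides. The bound is crude, but it allows one to
  infer a positive \<open>t_star\<close> from a positive LD makespan.\<close>

lemma makespan_le_machines_t_star:
  assumes "is_instance P"
  shows "makespan P \<sigma> \<le> real (machines P) * t_star P"
proof -
  have "machines P \<ge> 1"
    using assms by (simp add: is_instance_def)
  then obtain \<tau> where "optimal P \<tau>"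
    using ex_optimal by blast
  then show ?thesis
    using makespan_le_total_time[OF assms, of \<sigma>] total_time_le[of P \<tau>] by (simp add: optimal_def)
qed

lemma rectangular_makespan:
  assumes "rectangular P \<sigma>" "i \<in> {1..machines P}"
  shows "completion_time P \<sigma> i = makespan P \<sigma>"
proof -
  have "machines P \<ge> 1"
    using assms by simp
  then obtain i' where i': "i' \<in> {1..machines P}" "makespan P \<sigma> = completion_time P \<sigma> i'"
    by (rule makespan_attained)
  then have "completion_time P \<sigma> i = completion_time P \<sigma> i'"
    using assms unfolding rectangular_def by blast
  then show ?thesis
    using i'(2) by simp
qed

text \<open>A rectangular makespan equals the average load, which bounds every flowtime-optimal
  makespan from below.\<close>

lemma rectangular_imp_optimal:
  assumes m: "machines P \<ge> 1" and fo: "flowtime_optimal P \<sigma>" and re: "rectangular P \<sigma>"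
  shows "optimal P \<sigma>"
proof -
  obtain \<tau> where \<tau>: "optimal P \<tau>"
    using ex_optimal[OF m] by blast
  have "real (machines P) * makespan P \<sigma> = total_time P"
    using sum_completion_time[OF fo] rectangular_makespan[OF re] by simp
  also have "\<dots> \<le> real (machines P) * t_star P"
    using total_time_le[of P \<tau>] \<tau> by (simp add: optimal_def)
  finally have "makespan P \<sigma> \<le> t_star P"
    using m by simp
  then show ?thesis
    using t_star_le[OF m fo] fo by (simp add: optimal_def)
qed

section \<open>Monotonicity of LD\<close>

text \<open>
  A step of LD adds the jobs in decreasing order to the loads in increasing order, which is a
  monotone operation on sorted load vectors.
\<close>

lemma ld_load_dominated:
  assumes ld: "ld_schedule P \<sigma>" "ld_schedule Q \<tau>"
    and eq: "machines Q = machines P" "ranks Q = ranks P"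
    and dom: "\<And>r. r \<in> {1..ranks P} \<Longrightarrow> \<exists>b. bij_betw b (rank_jobs P r) (rank_jobs P r) \<and>
        (\<forall>j\<in>rank_jobs P r. ptime P (b j) - c \<le> ptime Q j)"
    and "r \<le> ranks P"
  shows "\<exists>b. bij_betw b {1..machines P} {1..machines P} \<and>
        (\<forall>i\<in>{1..machines P}. load P \<sigma> r i - real r * c \<le> load Q \<tau> r (b i))"
  using \<open>r \<le> ranks P\<close>
proof (induction r)
  case 0
  show ?case
    using bij_betw_id by fastforce
next
  case (Suc r)
  let ?m = "machines P" and ?R = "rank_jobs P (Suc r)"
  have R: "rank_jobs Q (Suc r) = ?R"
    by (simp add: rank_jobs_def eq)
  have r: "Suc r \<in> {1..ranks P}"
    using Suc.prems by simp
  obtain b where b: "bij_betw b {1..?m} {1..?m}"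
    and ble: "\<forall>i\<in>{1..?m}. load P \<sigma> r i - real r * c \<le> load Q \<tau> r (b i)"
    using Suc by auto
  obtain d where d: "bij_betw d ?R ?R" and dle: "\<forall>j\<in>?R. ptime P (d j) - c \<le> ptime Q j"
    using dom[OF r] by blast
  have st: "ld_step P \<sigma> (Suc r)" "ld_step Q \<tau> (Suc r)"
    using ld r eq by (auto simp: ld_schedule_def)
  obtain job mach where job: "bij_betw job {1..?m} ?R" and mach: "bij_betw mach {1..?m} {1..?m}"
    and ord: "\<forall>i\<in>{1..?m}. \<forall>i'\<in>{1..?m}. i \<le> i' \<longrightarrow> ptime P (job i') \<le> ptime P (job i) \<and>
      load P \<sigma> r (mach i) \<le> load P \<sigma> r (mach i')"
    and \<sigma>: "\<forall>i\<in>{1..?m}. \<sigma> (job i) = mach i"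
    using st(1) unfolding ld_step_def by auto
  obtain job' mach' where job': "bij_betw job' {1..?m} ?R"
    and mach': "bij_betw mach' {1..?m} {1..?m}"
    and ord': "\<forall>i\<in>{1..?m}. \<forall>i'\<in>{1..?m}. i \<le> i' \<longrightarrow> ptime Q (job' i') \<le> ptime Q (job' i) \<and>
      load Q \<tau> r (mach' i) \<le> load Q \<tau> r (mach' i')"
    and \<tau>: "\<forall>i\<in>{1..?m}. \<tau> (job' i) = mach' i"
    using st(2) unfolding ld_step_def R eq by auto
  \<comment> \<open>The bijection \<open>b\<close>, rewritten between positions in the two sorted
    lists of machines, so that the comparison of sorted vectors applies.\<close>
  define e where "e = inv_into {1..?m} mach' \<circ> (b \<circ> mach)"
  have e: "bij_betw e {1..?m} {1..?m}"
    unfolding e_def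
    using bij_betw_trans[OF bij_betw_trans[OF mach b] bij_betw_inv_into[OF mach']] .
  have loads: "load P \<sigma> r (mach i) - real r * c \<le> load Q \<tau> r (mach' i)" if "i \<in> {1..?m}" for i
  proof (rule sorted_le_of_bij_le[of ?m _ _ e i])
    show "\<forall>i\<in>{1..?m}. load P \<sigma> r (mach i) - real r * c \<le> load Q \<tau> r (mach' (e i))"
      using ble bij_betw_inv_into_right[OF mach'] bij_betwE[OF mach] bij_betwE[OF b]
      by (simp add: e_def)
  qed (use ord ord' e that in auto)
  \<comment> \<open>The same for \<open>d\<close> and the two lists of jobs.\<close>
  define h where "h = inv_into {1..?m} job \<circ> (d \<circ> job')"
  have h: "bij_betw h {1..?m} {1..?m}"
    unfolding h_def
    using bij_betw_trans[OF bij_betw_trans[OF job' d] bij_betw_inv_into[OF job]] .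
  have times: "ptime P (job i) - c \<le> ptime Q (job' i)" if "i \<in> {1..?m}" for i
  proof (rule antisorted_le_of_bij_le[of ?m _ _ h i])
    show "\<forall>i\<in>{1..?m}. ptime P (job (h i)) - c \<le> ptime Q (job' i)"
      using dle bij_betw_inv_into_right[OF job] bij_betwE[OF job'] bij_betwE[OF d]
      by (simp add: h_def)
  qed (use ord ord' h that in auto)
  have inj: "inj_on \<sigma> ?R" "inj_on \<tau> (rank_jobs Q (Suc r))"
    using ld_step_bij st by (auto simp: bij_betw_def)
  have step: "load P \<sigma> (Suc r) (mach i) - real (Suc r) * c \<le> load Q \<tau> (Suc r) (mach' i)"
    if i: "i \<in> {1..?m}" for i
  proof -
    have "load P \<sigma> (Suc r) (mach i) = load P \<sigma> r (mach i) + ptime P (job i)"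
      using i \<sigma> bij_betwE[OF job] by (intro load_Suc inj) auto
    moreover have "load Q \<tau> (Suc r) (mach' i) = load Q \<tau> r (mach' i) + ptime Q (job' i)"
      using i \<tau> bij_betwE[OF job'] R by (intro load_Suc inj) auto
    ultimately show ?thesis
      using loads[OF i] times[OF i] by (simp add: algebra_simps)
  qed
  \<comment> \<open>The new bijection pairs machines at equal positions of the two lists, since
    \<open>step\<close> compares loads position by position.\<close>
  have "bij_betw (mach' \<circ> inv_into {1..?m} mach) {1..?m} {1..?m}"
    using bij_betw_trans[OF bij_betw_inv_into[OF mach] mach'] .
  moreover have "load P \<sigma> (Suc r) i - real (Suc r) * c
      \<le> load Q \<tau> (Suc r) ((mach' \<circ> inv_into {1..?m} mach) i)" if "i \<in> {1..?m}" for i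
    using step[of "inv_into {1..?m} mach i"] bij_betwE[OF bij_betw_inv_into[OF mach]] that
      bij_betw_inv_into_right[OF mach that] by simp
  ultimately show ?case by blast
qed

text \<open>Each rank costs at most \<open>c\<close>. With \<open>c = 0\<close> this shows that ties
  are harmless, with \<open>c = 1\<close> that shortening costs LD at most the number of
  ranks.\<close>

lemma ld_makespan_dominated:
  assumes "ld_schedule P \<sigma>" "ld_schedule Q \<tau>" "machines Q = machines P" "ranks Q = ranks P"
    and "\<And>r. r \<in> {1..ranks P} \<Longrightarrow> \<exists>b. bij_betw b (rank_jobs P r) (rank_jobs P r) \<and>
        (\<forall>j\<in>rank_jobs P r. ptime P (b j) - c \<le> ptime Q j)"
    and m: "machines P \<ge> 1"
  shows "makespan P \<sigma> - real (ranks P) * c \<le> makespan Q \<tau>"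
proof -
  obtain i where i: "i \<in> {1..machines P}" "makespan P \<sigma> = completion_time P \<sigma> i"
    using makespan_attained[OF m] by blast
  obtain b where b: "bij_betw b {1..machines P} {1..machines P}"
    "\<forall>i\<in>{1..machines P}. load P \<sigma> (ranks P) i - real (ranks P) * c \<le> load Q \<tau> (ranks P) (b i)"
    using ld_load_dominated[OF assms(1-5) order_refl] by blast
  have "b i \<in> {1..machines Q}"
    using i b assms(3) by (auto dest: bij_betwE)
  from completion_time_le_makespan[OF this, of \<tau>] show ?thesis
    using i(2) b(2)[rule_format, OF i(1)] assms(4) by (simp add: completion_time_eq_load)
qed

text \<open>Domination of an instance by itself, in both directions, shows that tie-breaking does
  not affect the makespan; the \<open>Max\<close> ranges over a singleton.\<close>

lemma t_LD_eq:
  assumes m: "machines P \<ge> 1" and ld: "ld_schedule P \<sigma>"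
  shows "t_LD P = makespan P \<sigma>"
proof -
  have le: "makespan P \<rho> \<le> makespan P \<tau>" if "ld_schedule P \<rho>" "ld_schedule P \<tau>" for \<rho> \<tau>
  proof -
    have "\<exists>b. bij_betw b (rank_jobs P r) (rank_jobs P r) \<and>
        (\<forall>j\<in>rank_jobs P r. ptime P (b j) - 0 \<le> ptime P j)" for r
      by (rule exI[of _ id]) simp
    from ld_makespan_dominated[OF that refl refl this m] show ?thesis
      by simp
  qed
  have "{makespan P \<tau> | \<tau>. ld_schedule P \<tau>} = {makespan P \<sigma>}"
    using ld le by (auto intro: order_antisym)
  then show ?thesis
    by (simp add: t_LD_def)
qed

section \<open>Counterexamples and removable ranks\<close>

lemma counterexample_iff:
  "counterexample P \<longleftrightarrow> is_instance P \<and> t_LD P > cs_bound (machines P) * t_star P"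
proof (cases "is_instance P")
  case True
  then have "machines P \<ge> 1"
    by (simp add: is_instance_def)
  then show ?thesis
    unfolding counterexample_def not_le using ex_ld_schedule[of P] t_LD_eq[of P] by metis
qed (simp add: counterexample_def)

text \<open>The \<open>inv_into\<close> term is the unique job of rank \<open>r\<close> on machine
  \<open>i\<close>. This form allows losses to be counted rank by rank.\<close>

lemma completion_time_eq_sum:
  assumes "flowtime_optimal P \<sigma>" "i \<in> {1..machines P}"
  shows "completion_time P \<sigma> i = (\<Sum>r\<in>{1..ranks P}. ptime P (inv_into (rank_jobs P r) \<sigma> i))"
proof -
  have "load P \<sigma> r i = (\<Sum>r\<in>{1..r}. ptime P (inv_into (rank_jobs P r) \<sigma> i))" if "r \<le> ranks P" for r
    using that
  proof (induction r)
    case (Suc r)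
    then have "bij_betw \<sigma> (rank_jobs P (Suc r)) {1..machines P}"
      using assms by (simp add: flowtime_optimal_def)
    then have "load P \<sigma> (Suc r) i = load P \<sigma> r i + ptime P (inv_into (rank_jobs P (Suc r)) \<sigma> i)"
      using assms(2) by (intro load_Suc)
        (auto simp: bij_betw_def intro: inv_into_into f_inv_into_f)
    then show ?case
      using Suc by simp
  qed simp
  then show ?thesis
    by (simp add: completion_time_eq_load)
qed

lemma cs_bound_ge_1: "m \<ge> 1 \<Longrightarrow> cs_bound m \<ge> 1"
  by (simp add: cs_bound_def field_simps)

lemma ptime_le_t_star:
  assumes P: "is_instance P" and j: "j \<in> jobs P"
  shows "ptime P j \<le> t_star P"
proof -
  have "machines P \<ge> 1"
    using P by (simp add: is_instance_def)
  then obtain \<tau> where \<tau>: "flowtime_optimal P \<tau>" "makespan P \<tau> = t_star P"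
    using ex_optimal[of P] by (auto simp: optimal_def)
  have "ptime P j \<le> completion_time P \<tau> (\<tau> j)"
    unfolding completion_time_def using P j
    by (intro member_le_sum) (auto simp: is_instance_def jobs_def)
  also have "\<dots> \<le> t_star P"
    unfolding \<tau>(2)[symmetric]
    by (intro completion_time_le_makespan flowtime_optimal_range[OF \<tau>(1) j])
  finally show ?thesis .
qed

text \<open>Every machine runs a single job, so the LD makespan is one processing time and cannot
  exceed \<open>t_star\<close>.\<close>

lemma one_rank_not_counterexample:
  assumes "ranks P = 1"
  shows "\<not> counterexample P"
proof
  assume ce: "counterexample P"
  then have P: "is_instance P" and gt: "t_LD P > cs_bound (machines P) * t_star P"
    by (simp_all add: counterexample_iff)
  then have m: "machines P \<ge> 1"
    by (simp add: is_instance_def)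
  obtain \<sigma> where \<sigma>: "ld_schedule P \<sigma>"
    using ex_ld_schedule by blast
  note fo = ld_schedule_flowtime_optimal[OF \<sigma>]
  obtain i where i: "i \<in> {1..machines P}" "makespan P \<sigma> = completion_time P \<sigma> i"
    using makespan_attained[OF m] by blast
  let ?j = "inv_into (rank_jobs P 1) \<sigma> i"
  have "?j \<in> rank_jobs P 1"
    using fo i assms by (intro inv_into_into) (simp add: flowtime_optimal_def bij_betw_def)
  then have j: "?j \<in> jobs P"
    using rank_jobs_subset_jobs[of 1 P] assms by auto
  have "t_LD P = ptime P ?j"
    using t_LD_eq[OF m \<sigma>] i completion_time_eq_sum[OF fo i(1)] assms by simp
  also have "\<dots> \<le> t_star P"
    by (rule ptime_le_t_star[OF P j])
  also have "\<dots> \<le> cs_bound (machines P) * t_star P"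
    using mult_right_mono[OF cs_bound_ge_1[OF m], of "t_star P"] ptime_le_t_star[OF P j] P j
    by (force simp: is_instance_def)
  finally show False
    using gt by simp
qed

text \<open>Zero jobs do not change completion times, and schedules of \<open>P\<close> restrict to
  \<open>R\<close>. So the LD makespan stays, the optimum cannot grow, and a rectangular schedule
  stays rectangular.\<close>

lemma drop_zero_rank:
  assumes ce: "counterexample P" and k: "ranks P \<ge> 2"
    and zero: "\<forall>j\<in>rank_jobs P (ranks P). ptime P j = 0" and ty: "has_type T P"
  defines "R \<equiv> P\<lparr>ranks := ranks P - 1\<rparr>"
  shows "counterexample R \<and> has_type T R"
proof -
  have sel [simp]: "machines R = machines P" "ranks R = ranks P - 1" "ptime R = ptime P"
    by (simp_all add: R_def)
  have P: "is_instance P"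
    using ce by (simp add: counterexample_def)
  then have m: "machines P \<ge> 1"
    by (simp add: is_instance_def)
  have sub: "jobs R \<subseteq> jobs P"
    by (auto simp: jobs_def intro: order_trans)
  have rest: "ptime P j = 0" if "j \<in> jobs P - jobs R" for j
    using that zero by (auto simp: jobs_def rank_jobs_def mult.commute)
  have "finite (jobs P)"
    by (simp add: jobs_def)
  then have "completion_time R \<sigma> i = completion_time P \<sigma> i" for \<sigma> i
    unfolding completion_time_def sel(3)
    by (intro sum.mono_neutral_left) (use sub rest in auto)
  then have ct: "completion_time R \<sigma> = completion_time P \<sigma>" for \<sigma>
    by blast
  then have ms: "makespan R \<sigma> = makespan P \<sigma>" for \<sigma>
    by (simp add: makespan_def)
  have fo: "flowtime_optimal R \<sigma>" if "flowtime_optimal P \<sigma>" for \<sigma>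
    using that by (auto simp: flowtime_optimal_def rank_jobs_def)
  have inst: "is_instance R"
    using P sub k by (auto simp: is_instance_def subset_iff)
  have ld: "ld_schedule R \<sigma>" if "ld_schedule P \<sigma>" for \<sigma>
  proof -
    have "ld_step R \<sigma> r = ld_step P \<sigma> r" for r
      by (simp add: ld_step_def rank_jobs_def load_def)
    then show ?thesis
      using that by (auto simp: ld_schedule_def)
  qed
  obtain \<sigma> where \<sigma>: "ld_schedule P \<sigma>"
    using ex_ld_schedule by blast
  have tLD: "t_LD R = t_LD P"
    using t_LD_eq[OF m \<sigma>] t_LD_eq[OF _ ld[OF \<sigma>]] m ms by simp
  obtain \<tau> where \<tau>: "optimal P \<tau>"
    using ex_optimal[OF m] by blast
  have "t_star R \<le> t_star P"
    using t_star_le[of R \<tau>] fo[of \<tau>] \<tau> m ms[of \<tau>] by (simp add: optimal_def)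
  then have "cs_bound (machines P) * t_star R \<le> cs_bound (machines P) * t_star P"
    using cs_bound_ge_1[OF m] by (intro mult_left_mono) auto
  then have "counterexample R"
    using ce inst tLD by (simp add: counterexample_iff)
  moreover have "integral_instance R" if "integral_instance P"
    using that sub by (auto simp: integral_instance_def)
  moreover have "rectangular_instance R" if rect: "rectangular_instance P"
  proof -
    obtain \<rho> where "optimal P \<rho>" "rectangular P \<rho>"
      using rect by (auto simp: rectangular_instance_def)
    then have "flowtime_optimal R \<rho>" "rectangular R \<rho>"
      using fo unfolding rectangular_def optimal_def ct sel by blast+
    then show ?thesis
      using rectangular_imp_optimal[of R \<rho>] m by (auto simp: rectangular_instance_def)
  qed
  ultimately show ?thesis
    using ty by (cases T) auto
qed

lemma minimal_counterexample_ranks: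
  assumes "minimal_counterexample T P"
  shows "ranks P \<ge> 2"
proof -
  have "ranks P \<ge> 1" "counterexample P"
    using assms by (auto simp: minimal_counterexample_def counterexample_def is_instance_def)
  then show ?thesis
    using one_rank_not_counterexample[of P] by (cases "ranks P = 1") auto
qed

lemma minimal_counterexample_last_rank:
  assumes "minimal_counterexample T P"
  shows "\<exists>j\<in>rank_jobs P (ranks P). ptime P j \<noteq> 0"
proof (rule ccontr)
  assume *: "\<not> ?thesis"
  let ?R = "P\<lparr>ranks := ranks P - 1\<rparr>"
  note k = minimal_counterexample_ranks[OF assms]
  have "counterexample ?R \<and> has_type T ?R"
    using * assms k by (intro drop_zero_rank) (auto simp: minimal_counterexample_def)
  moreover have "smaller T ?R P"
    using k by (simp add: smaller_def)
  ultimately show False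
    using assms by (auto simp: minimal_counterexample_def)
qed

section \<open>Integral instances with a positive job in the last rank\<close>

lemma integral_ptime_ge_1:
  assumes "is_instance P" "integral_instance P" "j \<in> jobs P" "ptime P j \<noteq> 0"
  shows "ptime P j \<ge> 1"
  using assms Ints_nonzero_abs_ge1[of "ptime P j"]
  by (auto simp: is_instance_def integral_instance_def)

text \<open>Jobs of earlier ranks precede \<open>l\<close> in the decreasing numbering, so they are
  at least as long as \<open>l\<close>.\<close>

lemma full_machine_ptime_ge_1:
  assumes P: "is_instance P" and int: "integral_instance P"
    and l: "l \<in> rank_jobs P (ranks P)" "ptime P l \<noteq> 0"
    and j: "j \<in> rank_jobs P r" "r \<in> {1..<ranks P}"
  shows "ptime P j \<ge> 1"
proof -
  have k: "ranks P \<in> {1..ranks P}"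
    using P by (simp add: is_instance_def)
  have l': "l \<in> jobs P"
    using rank_jobs_subset_jobs[OF k] l by blast
  have j': "j \<in> jobs P"
    using rank_jobs_subset_jobs[of r P] j by auto
  have "r * machines P \<le> (ranks P - 1) * machines P"
    using j by (intro mult_right_mono) auto
  moreover have "j \<le> r * machines P" "(ranks P - 1) * machines P < l"
    using j l by (auto simp: rank_jobs_def)
  ultimately have "j \<le> l"
    by linarith
  then have "ptime P l \<le> ptime P j"
    using P l' j' by (auto simp: is_instance_def)
  then show ?thesis
    using integral_ptime_ge_1[OF P int l' l(2)] by simp
qed

text \<open>In an optimal schedule, the machine running \<open>l\<close> has one job of each rank,
  all of length at least 1.\<close>

lemma ranks_le_t_star:
  assumes P: "is_instance P" and int: "integral_instance P"
    and l: "l \<in> rank_jobs P (ranks P)" "ptime P l \<noteq> 0"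
  shows "real (ranks P) \<le> t_star P"
proof -
  let ?k = "ranks P"
  have m: "machines P \<ge> 1" and k: "?k \<in> {1..?k}"
    using P by (simp_all add: is_instance_def)
  obtain \<tau> where \<tau>: "flowtime_optimal P \<tau>" "makespan P \<tau> = t_star P"
    using ex_optimal[OF m] by (auto simp: optimal_def)
  have bij: "bij_betw \<tau> (rank_jobs P r) {1..machines P}" if "r \<in> {1..?k}" for r
    using \<tau> that by (simp add: flowtime_optimal_def)
  have l': "l \<in> jobs P"
    using rank_jobs_subset_jobs[OF k] l by blast
  have i: "\<tau> l \<in> {1..machines P}"
    by (rule flowtime_optimal_range[OF \<tau>(1) l'])
  have "1 \<le> ptime P (inv_into (rank_jobs P r) \<tau> (\<tau> l))" if r: "r \<in> {1..?k}" for r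
  proof (cases "r = ?k")
    case True
    then show ?thesis
      using bij_betw_inv_into_left[OF bij[OF k] l(1)] integral_ptime_ge_1[OF P int l' l(2)] by simp
  next
    case False
    have "inv_into (rank_jobs P r) \<tau> (\<tau> l) \<in> rank_jobs P r"
      using bij_betwE[OF bij_betw_inv_into[OF bij[OF r]]] i by blast
    then show ?thesis
      using False r by (intro full_machine_ptime_ge_1[OF P int l]) auto
  qed
  then have "real ?k \<le> completion_time P \<tau> (\<tau> l)"
    using sum_bounded_below[of "{1..?k}" 1 "\<lambda>r. ptime P (inv_into (rank_jobs P r) \<tau> (\<tau> l))"]
    unfolding completion_time_eq_sum[OF \<tau>(1) i] by simp
  also have "\<dots> \<le> t_star P"
    using completion_time_le_makespan[OF i, of \<tau>] \<tau>(2) by simp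
  finally show ?thesis .
qed

section \<open>The shortened instance\<close>

text \<open>
  Each positive job of ranks \<open>2..k\<close> is shortened by one, and a rank \<open>1\<close> job is shortened exactly if
  its machine runs a zero job of rank \<open>k\<close>, so every machine loses exactly \<open>k - 1\<close>.  This can
  destroy the order inside rank \<open>1\<close>, which is restored by the permutation \<open>\<pi>\<close>.
\<close>

lemma shortened_instance:
  assumes P: "is_instance P" and int: "integral_instance P" and k: "ranks P \<ge> 2"
    and l: "l \<in> rank_jobs P (ranks P)" "ptime P l \<noteq> 0"
    and \<sigma>: "flowtime_optimal P \<sigma>"
  shows "\<exists>Q \<tau>. is_instance Q \<and> integral_instance Q \<and> machines Q = machines P \<and> ranks Q = ranks P \<and>
    nonzero_jobs Q \<le> nonzero_jobs P \<and> total_time Q < total_time P \<and>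
    t_LD P - real (ranks P) \<le> t_LD Q \<and> flowtime_optimal Q \<tau> \<and>
    (\<forall>i\<in>{1..machines P}. completion_time Q \<tau> i = completion_time P \<sigma> i - (real (ranks P) - 1))"
proof -
  let ?m = "machines P" and ?k = "ranks P" and ?p = "ptime P"
  define lst where "lst i = inv_into (rank_jobs P ?k) \<sigma> i" for i
  \<comment> \<open>Jobs up to \<open>?m\<close> form rank 1, and \<open>lst (\<sigma> j)\<close> is
    the rank \<open>?k\<close> job on the machine of \<open>j\<close>. The \<open>max\<close> leaves
    zero jobs at zero.\<close>
  define h where "h j = (if j \<le> ?m then (if ?p (lst (\<sigma> j)) = 0 then ?p j - 1 else ?p j)
    else max (?p j - 1) 0)" for j
  have m: "?m \<ge> 1"
    using P by (simp add: is_instance_def)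
  have rank1: "rank_jobs P 1 = {1..?m}"
    by (simp add: rank_jobs_def)
  have mk: "?m \<le> ?m * ?k"
    using k by simp
  have nonneg: "0 \<le> ?p j" if "j \<in> jobs P" for j
    using P that by (simp add: is_instance_def)
  have antimono: "?p j \<le> ?p i" if "i \<in> jobs P" "j \<in> jobs P" "i \<le> j" for i j
    using P that by (simp add: is_instance_def)
  have first: "1 \<le> ?p j" if "j \<in> {1..?m}" for j
    using full_machine_ptime_ge_1[OF P int l, of j 1] that k rank1 by simp
  obtain s where s: "bij_betw s {1..?m} {1..?m}"
    and ord: "\<forall>i\<in>{1..?m}. \<forall>j\<in>{1..?m}. i \<le> j \<longrightarrow> - h (s i) \<le> - h (s j)"
    using ex_sorting_bij[of "{1..?m}" ?m "\<lambda>j. - h j"] by auto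
  \<comment> \<open>Only rank 1 needs sorting: beyond it all times undergo the same monotone
    truncated subtraction.\<close>
  define \<pi> where "\<pi> j = (if j \<in> {1..?m} then s j else j)" for j
  have \<pi>1: "bij_betw \<pi> {1..?m} {1..?m}"
    using s bij_betw_cong[of "{1..?m}" \<pi> s] by (simp add: \<pi>_def)
  have \<pi>2: "bij_betw \<pi> A A" if "A \<inter> {1..?m} = {}" for A
  proof -
    have "\<pi> j = id j" if "j \<in> A" for j
      using that \<open>A \<inter> {1..?m} = {}\<close> unfolding \<pi>_def by auto
    then show ?thesis
      using bij_betw_cong[of A \<pi> id A] by simp
  qed
  have \<pi>r: "bij_betw \<pi> (rank_jobs P r) (rank_jobs P r)" if "r \<in> {1..?k}" for r
  proof (cases "r = 1")
    case True
    then show ?thesis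
      using \<pi>1 rank1 by simp
  next
    case False
    then show ?thesis
      using that rank_jobs_gt[of r _ P] by (intro \<pi>2) fastforce
  qed
  have \<pi>: "bij_betw \<pi> (jobs P) (jobs P)"
  proof -
    have "jobs P = {1..?m} \<union> {?m<..?m * ?k}"
      by (auto simp: jobs_def intro: order_trans[OF _ mk])
    moreover have "{1..?m} \<inter> {?m<..?m * ?k} = {}"
      by auto
    ultimately show ?thesis
      using bij_betw_combine[OF \<pi>1 \<pi>2[of "{?m<..?m * ?k}"]] by (simp add: Int_commute)
  qed
  define Q where "Q = \<lparr>machines = ?m, ranks = ?k, ptime = h \<circ> \<pi>\<rparr>"
  \<comment> \<open>Job \<open>j\<close> of \<open>Q\<close> has the time \<open>h (\<pi> j)\<close>
    and so takes the machine of \<open>\<pi> j\<close>; each machine then carries the same times as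
    under \<open>h\<close> and \<open>\<sigma>\<close>.\<close>
  define \<tau> where "\<tau> = \<sigma> \<circ> \<pi>"
  have sel [simp]: "machines Q = ?m" "ranks Q = ?k" "ptime Q = h \<circ> \<pi>"
    by (simp_all add: Q_def)
  have jobs [simp]: "jobs Q = jobs P" and rank_jobs [simp]: "rank_jobs Q r = rank_jobs P r" for r
    by (simp_all add: jobs_def rank_jobs_def)
  have h_ge: "h j \<ge> ?p j - 1" for j
    by (simp add: h_def)
  have h_nonneg: "0 \<le> h j" if "j \<in> jobs P" for j
    using first[of j] that by (auto simp: h_def jobs_def)
  have \<pi>_jobs: "\<pi> j \<in> jobs P" if "j \<in> jobs P" for j
    using bij_betwE[OF \<pi>] that by blast
  have inst: "is_instance Q"
    unfolding is_instance_def sel jobs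
  proof (intro conjI ballI impI)
    fix i j assume ij: "i \<in> jobs P" "j \<in> jobs P" "i \<le> j"
    show "(h \<circ> \<pi>) j \<le> (h \<circ> \<pi>) i"
    proof (cases "j \<le> ?m")
      case True
      then show ?thesis
        using ord ij by (auto simp: \<pi>_def jobs_def)
    next
      case False
      \<comment> \<open>As \<open>j\<close> lies beyond rank 1, it drops to the truncation of
        \<open>?p j - 1\<close>, while \<open>\<pi> i\<close> loses at most one; hence comparing the
        original times suffices.\<close>
      have "?p j \<le> ?p (\<pi> i)"
      proof (cases "i \<le> ?m")
        case True
        then have "\<pi> i \<in> {1..?m}"
          using bij_betwE[OF \<pi>1] ij by (auto simp: jobs_def)
        then show ?thesis
          using False ij \<pi>_jobs by (intro antimono) auto
      next
        case False
        then show ?thesis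
          using ij by (auto simp: \<pi>_def intro: antimono)
      qed
      then have "?p j - 1 \<le> h (\<pi> i)"
        using h_ge[of "\<pi> i"] by linarith
      then show ?thesis
        using False h_nonneg[OF \<pi>_jobs[OF ij(1)]] by (simp add: \<pi>_def h_def)
    qed
  qed (use P h_nonneg \<pi>_jobs in \<open>auto simp: is_instance_def\<close>)
  have h_int: "h j \<in> \<int>" if "j \<in> jobs P" for j
    using int that by (auto simp: h_def integral_instance_def max_def)
  have intQ: "integral_instance Q"
    using h_int \<pi>_jobs by (simp add: integral_instance_def)
  have foQ: "flowtime_optimal Q \<tau>"
    unfolding flowtime_optimal_def sel rank_jobs \<tau>_def
    using \<sigma> \<pi>r bij_betw_trans unfolding flowtime_optimal_def by blast
  have ct: "completion_time Q \<tau> i = completion_time P \<sigma> i - (real ?k - 1)" if i: "i \<in> {1..?m}" for i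
  proof -
    \<comment> \<open>The times \<open>h\<close> in the original numbering. They need not be sorted,
      but the rank-wise sum only asks for a flowtime-optimal schedule.\<close>
    let ?H = "P\<lparr>ptime := h\<rparr>"
    let ?J = "\<lambda>r. inv_into (rank_jobs P r) \<sigma> i"
    have bij: "bij_betw \<sigma> (rank_jobs P r) {1..?m}" if "r \<in> {1..?k}" for r
      using \<sigma> that by (simp add: flowtime_optimal_def)
    have J: "?J r \<in> rank_jobs P r" "\<sigma> (?J r) = i" if "r \<in> {1..?k}" for r
      using bij_betwE[OF bij_betw_inv_into[OF bij[OF that]]] i
        bij_betw_inv_into_right[OF bij[OF that] i] by blast+
    have H: "rank_jobs ?H r = rank_jobs P r" "jobs ?H = jobs P" for r
      by (simp_all add: rank_jobs_def jobs_def)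
    have foH: "flowtime_optimal ?H \<sigma>"
      using \<sigma> by (simp add: flowtime_optimal_def H)
    have "bij_betw \<pi> {j. j \<in> jobs P \<and> \<tau> j = i} {j. j \<in> jobs P \<and> \<sigma> j = i}"
      using \<pi> unfolding bij_betw_def inj_on_def \<tau>_def by (auto simp: image_iff)
    from sum.reindex_bij_betw[OF this, of h]
    have "completion_time Q \<tau> i = completion_time ?H \<sigma> i"
      by (simp add: completion_time_def H)
    also have "\<dots> = (\<Sum>r\<in>{1..?k}. h (?J r))"
      using completion_time_eq_sum[OF foH, of i] i by (simp add: H)
    \<comment> \<open>Charge one unit to every rank, then refund one: to rank 1 if the last job is
      positive, and to rank \<open>?k\<close> if that job is zero and has nothing to lose. Exactly
      one refund occurs.\<close>
    also have "\<dots> = (\<Sum>r\<in>{1..?k}. ?p (?J r) - 1 + (if r = 1 then of_bool (?p (?J ?k) \<noteq> 0) else 0)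
        + (if r = ?k then of_bool (?p (?J ?k) = 0) else 0))"
    proof (rule sum.cong[OF refl])
      fix r assume r: "r \<in> {1..?k}"
      note Jr = J[OF r]
      consider "r = 1" | "r = ?k" "r \<noteq> 1" | "r \<noteq> 1" "r < ?k"
        using r by fastforce
      then show "h (?J r) = ?p (?J r) - 1 + (if r = 1 then of_bool (?p (?J ?k) \<noteq> 0) else 0)
        + (if r = ?k then of_bool (?p (?J ?k) = 0) else 0)"
      proof cases
        case 1
        then have "?J r \<le> ?m"
          using Jr rank1 by auto
        then show ?thesis
          using 1 k Jr by (simp add: h_def lst_def)
      next
        case 2
        have "\<not> ?J r \<le> ?m"
          using 2 r rank_jobs_gt[OF _ Jr(1)] by auto
        moreover have "?J r \<in> jobs P"
          using Jr rank_jobs_subset_jobs[OF r] by blast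
        ultimately show ?thesis
          using 2 k integral_ptime_ge_1[OF P int, of "?J r"] by (auto simp: h_def)
      next
        case 3
        have "\<not> ?J r \<le> ?m"
          using 3 r rank_jobs_gt[OF _ Jr(1)] by auto
        moreover have "1 \<le> ?p (?J r)"
          using 3 r by (intro full_machine_ptime_ge_1[OF P int l Jr(1)]) auto
        ultimately show ?thesis
          using 3 by (simp add: h_def)
      qed
    qed
    also have "\<dots> = (\<Sum>r\<in>{1..?k}. ?p (?J r)) - (real ?k - 1)"
      using k by (simp add: sum.distrib sum_subtractf)
    finally show ?thesis
      using completion_time_eq_sum[OF \<sigma> i] by simp
  qed
  have "total_time Q = (\<Sum>i\<in>{1..?m}. completion_time P \<sigma> i - (real ?k - 1))"
    using sum_completion_time[OF foQ] ct by simp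
  also have "\<dots> = total_time P - real ?m * (real ?k - 1)"
    using sum_completion_time[OF \<sigma>] by (simp add: sum_subtractf)
  also have "\<dots> < total_time P"
    using m k by simp
  finally have total: "total_time Q < total_time P" .
  \<comment> \<open>Rank 1 is entirely positive in \<open>P\<close>, so permuting it creates no new
    nonzero job.\<close>
  have "?p j \<noteq> 0" if "j \<in> jobs P" "h (\<pi> j) \<noteq> 0" for j
    using that first[of j] by (cases "j \<le> ?m") (auto simp: \<pi>_def h_def jobs_def)
  then have nonzero: "nonzero_jobs Q \<le> nonzero_jobs P"
    unfolding nonzero_jobs_def by (intro card_mono) (auto simp: jobs_def)
  obtain \<rho> \<rho>' where \<rho>: "ld_schedule P \<rho>" "ld_schedule Q \<rho>'"
    using ex_ld_schedule by blast
  \<comment> \<open>Domination with \<open>c = 1\<close> and \<pi> as the bijection of each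
    rank.\<close>
  have "makespan P \<rho> - real ?k * 1 \<le> makespan Q \<rho>'"
    using \<rho> m \<pi>r h_ge by (intro ld_makespan_dominated) auto
  then have "t_LD P - real ?k \<le> t_LD Q"
    using t_LD_eq \<rho> m by simp
  then show ?thesis
    using inst intQ nonzero total foQ ct by (intro exI[of _ Q] exI[of _ \<tau>]) simp
qed

section \<open>The ratio of a minimal counterexample\<close>

lemma minimal_counterexample_ratio:
  assumes min: "minimal_counterexample T P" and T: "T \<in> {Type_I, Type_IR}"
  shows "t_LD P / t_star P < real (ranks P) / (real (ranks P) - 1)"
proof (rule ccontr)
  let ?k = "real (ranks P)" and ?c = "cs_bound (machines P)"
  assume "\<not> ?thesis"
  then have ge: "?k / (?k - 1) \<le> t_LD P / t_star P"
    by simp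
  have ce: "is_instance P" "t_LD P > ?c * t_star P" and ty: "has_type T P"
    using min by (auto simp: minimal_counterexample_def counterexample_iff)
  have int: "integral_instance P"
    using ty T by auto
  have m: "machines P \<ge> 1"
    using ce by (simp add: is_instance_def)
  have k: "ranks P \<ge> 2"
    by (rule minimal_counterexample_ranks[OF min])
  obtain l where l: "l \<in> rank_jobs P (ranks P)" "ptime P l \<noteq> 0"
    using minimal_counterexample_last_rank[OF min] by blast
  have t: "?k \<le> t_star P"
    by (rule ranks_le_t_star[OF ce(1) int l])
  \<comment> \<open>For \<open>Type_IR\<close> a rectangular optimum is chosen, as equal losses on
    all machines keep it rectangular; for \<open>Type_I\<close> any optimum serves.\<close>
  obtain \<sigma> where \<sigma>: "flowtime_optimal P \<sigma>" "makespan P \<sigma> = t_star P"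
    and rect: "T = Type_IR \<Longrightarrow> rectangular P \<sigma>"
    using ty T ex_optimal[OF m] by (auto simp: rectangular_instance_def optimal_def)
  obtain Q \<tau> where Q: "is_instance Q" "integral_instance Q" "machines Q = machines P"
    "ranks Q = ranks P" "nonzero_jobs Q \<le> nonzero_jobs P" "total_time Q < total_time P"
    "t_LD P - ?k \<le> t_LD Q" "flowtime_optimal Q \<tau>"
    and ct: "\<forall>i\<in>{1..machines P}. completion_time Q \<tau> i = completion_time P \<sigma> i - (?k - 1)"
    using shortened_instance[OF ce(1) int k l \<sigma>(1)] by blast
  have mQ: "machines Q \<ge> 1"
    using m Q by simp
  obtain i where i: "i \<in> {1..machines Q}" "makespan Q \<tau> = completion_time Q \<tau> i"
    using makespan_attained[OF mQ] by blast
  have tQ: "t_star Q \<le> t_star P - (?k - 1)"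
    using t_star_le[OF mQ Q(8)] i ct completion_time_le_makespan[of i P \<sigma>] \<sigma>(2) Q(3) by simp
  have LD: "?k * t_star P \<le> (?k - 1) * t_LD P"
    using ge t k by (simp add: field_simps)
  \<comment> \<open>The bound \<open>?k \<le> t_star P\<close> makes \<open>t_LD P\<close> exceed
    \<open>?k\<close>, so the LD makespan of \<open>Q\<close> stays positive after losing up to
    \<open>?k\<close>.\<close>
  have "(?k - 1) * ?k < ?k * ?k"
    using k by simp
  also have "\<dots> \<le> ?k * t_star P"
    using t by (intro mult_left_mono) auto
  also note LD
  finally have "(?k - 1) * ?k < (?k - 1) * t_LD P" .
  then have "t_LD P > ?k"
    using k by simp
  then have posLD: "t_LD Q > 0"
    using Q(7) by simp
  obtain \<rho> where "ld_schedule Q \<rho>"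
    using ex_ld_schedule by blast
  \<comment> \<open>A positive LD makespan excludes \<open>t_star Q = 0\<close>, which allows
    cross-multiplication of the ratios.\<close>
  then have "t_LD Q \<le> real (machines Q) * t_star Q"
    using makespan_le_machines_t_star[OF Q(1)] t_LD_eq[OF mQ] by simp
  then have pos: "t_star Q > 0"
    using posLD mQ by (smt (verit) mult_nonneg_nonpos of_nat_0_le_iff)
  \<comment> \<open>By \<open>LD\<close>, the relative loss of the optimum is at least that of LD;
    here this is written without division.\<close>
  have "t_LD P * t_star Q \<le> t_LD P * (t_star P - (?k - 1))"
    using tQ \<open>t_LD P > ?k\<close> by (intro mult_left_mono) auto
  also have "\<dots> \<le> (t_LD P - ?k) * t_star P"
    using LD by (simp add: algebra_simps)
  also have "\<dots> \<le> t_LD Q * t_star P"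
    using Q(7) t by (intro mult_right_mono) auto
  finally have ratio: "approx_ratio P \<le> approx_ratio Q"
    using pos t k by (simp add: approx_ratio_def field_simps)
  have "?c < approx_ratio P"
    using ce(2) t k by (simp add: approx_ratio_def field_simps)
  then have "?c < approx_ratio Q"
    using ratio by simp
  then have ceQ: "counterexample Q"
    using pos Q by (simp add: counterexample_iff approx_ratio_def field_simps)
  have "rectangular Q \<tau>" if "T = Type_IR"
    unfolding rectangular_def Q(3)
  proof (intro ballI)
    fix i i' assume ii: "i \<in> {1..machines P}" "i' \<in> {1..machines P}"
    then have "completion_time P \<sigma> i = completion_time P \<sigma> i'"
      using rect[OF that] unfolding rectangular_def by blast
    then show "completion_time Q \<tau> i = completion_time Q \<tau> i'"
      using ct ii by simp
  qed
  then have "has_type T Q"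
    using T Q(2) rectangular_imp_optimal[OF mQ Q(8)] by (auto simp: rectangular_instance_def)
  \<comment> \<open>Fewer nonzero jobs or a larger ratio decide at once; if both are equal, the
    smaller total time does.\<close>
  moreover have "smaller T Q P"
    using Q ratio T by (auto simp: smaller_def)
  ultimately show False
    using min ceQ by (auto simp: minimal_counterexample_def)
qed

theorem theorem7p5:
  assumes "\<not> coffman_sethi_conjecture"
  shows "(\<forall>P. minimal_counterexample Type_IR P \<longrightarrow>
            t_LD P / t_star P < real (ranks P) / (real (ranks P) - 1)) \<and>
         (\<forall>P. minimal_counterexample Type_I P \<longrightarrow>
            t_LD P / t_star P < real (ranks P) / (real (ranks P) - 1))"
  by (simp add: minimal_counterexample_ratio)

end
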